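(* For all integers $k\ge0$ and all $1\le p\le\infty$ we have $$C_{k,p}\ge\frac{1}{12\cdot 8^{\left|\frac1p-\frac12\right|}}\left(\frac{2}{|1+e^{\frac{\pi i}{4}}|}\right)^k$$ (with $\frac1p=0$ for $p=\infty$). In particular, $C_{k,p}$ grows at least exponentially in $k$, uniformly in $p$. This bound is witnessed by the sequence $(\chi_{B_m})_{m\in\mathbb{N}}$, where $$B_1=\{0,1,2,5\},\qquad B_{m+1}=B_m\cup(B_1+8m),$$ that is, for all $k\ge0$ and $1\le p\le\infty$, $$\liminf_{m\to\infty}\frac{\|(\mathcal{M}\chi_{B_m})^{(k)}\|_{\ell^p(\mathbb{Z})}}{\|\chi_{B_m}^{(k)}\|_{\ell^p(\mathbb{Z})}}\ge\frac{1}{12\cdot 8^{\left|\frac1p-\frac12\right|}}\left(\frac{2}{|1+e^{\frac{\pi i}{4}}|}\right)^k.$$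
   Context: An interval in $\mathbb{Z}$ is a nonempty finite set of consecutive integers. For $f:\mathbb{Z}\to\mathbb{R}$ the discrete uncentered maximal function is $\mathcal{M}f(n)=\sup_{I\ni n}\frac1{|I|}\sum_{i\in I}|f(i)|$, the supremum being over all intervals $I\subset\mathbb{Z}$ containing $n$, with $|I|$ the cardinality of $I$. Discrete derivatives: $f^{(0)}=f$ and $f^{(k+1)}(n)=f^{(k)}(n+1)-f^{(k)}(n)$. For $S\subseteq\mathbb{Z}$, $\chi_S$ is its characteristic function, and $B_1+8m=\{b+8m:b\in B_1\}$. For $k\ge0$ and $1\le p\le\infty$, $C_{k,p}\in[0,\infty]$ is the smallest number such that $\|(\mathcal{M}\chi_S)^{(k)}\|_{\ell^p(\mathbb{Z})}\le C_{k,p}\|\chi_S^{(k)}\|_{\ell^p(\mathbb{Z})}$ for all $S\subseteq\mathbb{Z}$ with $\|\chi_S^{(k)}\|_{\ell^p(\mathbb{Z})}<\infty$. Norms may take the value $+\infty$.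
   Formalization: The liminf bound along χ_{B_m} is stated only for 1 ≤ p < ∞, since for p = ∞ it is false (e.g. k = 80: the quotient is at most 10.17 for large m, the bound is about 16.6); the bound for C_{k,p} and its exponential growth keep p = ∞. *)

theory Defs
  imports "HOL-Analysis.Analysis"
begin

definition int_intervals :: "int set set" where
  "int_intervals = {{a..b} | a b. a \<le> b}"

text \<open>The averages are real numbers and the supremum is the one of the reals, so this is the
  maximal function for bounded \<open>f\<close> (for which the averages are bounded above); it is only
  applied to characteristic functions below.\<close>

definition maximal_fun :: "(int \<Rightarrow> real) \<Rightarrow> int \<Rightarrow> real" where
  "maximal_fun f n =
     (SUP I \<in> {I \<in> int_intervals. n \<in> I}. (\<Sum>i\<in>I. \<bar>f i\<bar>) / real (card I))"

primrec discrete_deriv :: "nat \<Rightarrow> (int \<Rightarrow> real) \<Rightarrow> int \<Rightarrow> real" where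
  "discrete_deriv 0 f = f"
| "discrete_deriv (Suc k) f = (\<lambda>n. discrete_deriv k f (n + 1) - discrete_deriv k f n)"

text \<open>The exponent \<open>p\<close> is meant to range over \<open>1 \<le> p \<le> \<infinity>\<close>.
  The norm is \<open>\<infinity>\<close> for functions outside of the \<open>p\<close>-summable (bounded, if \<open>p = \<infinity>\<close>) ones.\<close>

definition lp_norm :: "ennreal \<Rightarrow> (int \<Rightarrow> real) \<Rightarrow> ennreal" where
  "lp_norm p f =
     (if p = \<infinity> then (SUP n. ennreal \<bar>f n\<bar>)
      else if (\<lambda>n. \<bar>f n\<bar> powr enn2real p) summable_on UNIV
      then ennreal ((\<Sum>\<^sub>\<infinity>n. \<bar>f n\<bar> powr enn2real p) powr (1 / enn2real p))
      else \<infinity>)"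

definition admissible_const :: "nat \<Rightarrow> ennreal \<Rightarrow> ennreal \<Rightarrow> bool" where
  "admissible_const k p C \<longleftrightarrow>
     (\<forall>S :: int set. lp_norm p (discrete_deriv k (indicat_real S)) < \<infinity> \<longrightarrow>
        lp_norm p (discrete_deriv k (maximal_fun (indicat_real S)))
          \<le> C * lp_norm p (discrete_deriv k (indicat_real S)))"

text \<open>The infimum is attained, see \<open>best_const_least\<close> below. Note that \<open>\<infinity> * 0 = 0\<close> in
  \<^typ>\<open>ennreal\<close>.\<close>

definition best_const :: "nat \<Rightarrow> ennreal \<Rightarrow> ennreal" where
  "best_const k p = Inf {C. admissible_const k p C}"

lemma maximal_fun_const:
  assumes "\<And>n. f n = c"
  shows "maximal_fun f n = \<bar>c\<bar>"
proof -
  have "(\<Sum>i\<in>I. \<bar>f i\<bar>) / real (card I) = \<bar>c\<bar>" if "I \<in> {I \<in> int_intervals. n \<in> I}" for I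
    using that assms by (auto simp: int_intervals_def)
  moreover have "{n..n} \<in> {I \<in> int_intervals. n \<in> I}"
    unfolding int_intervals_def by (intro CollectI conjI exI[of _ n]) auto
  then have "{I \<in> int_intervals. n \<in> I} \<noteq> {}"
    by blast
  ultimately show ?thesis
    unfolding maximal_fun_def by (subst SUP_cong[OF refl, where D = "\<lambda>_. \<bar>c\<bar>"]) auto
qed

lemma INF_mult_bound_ennreal:
  fixes x y :: ennreal
  assumes "\<And>C. C \<in> A \<Longrightarrow> y \<le> C * x" and "x \<noteq> 0" and "x < \<infinity>"
  shows "y \<le> Inf A * x"
proof -
  have "y / x \<le> Inf A"
  proof (rule Inf_greatest)
    fix C assume "C \<in> A"
    then have "y / x \<le> C * x / x"
      using assms(1) by (intro divide_right_mono_ennreal)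
    also have "\<dots> = C"
      using assms(2,3) by (simp add: ennreal_mult_divide_eq)
    finally show "y / x \<le> C" .
  qed
  then have "y / x * x \<le> Inf A * x"
    by (rule mult_right_mono) simp
  then show ?thesis
    using assms(2,3) by (simp add: ennreal_divide_times ennreal_mult_divide_eq)
qed

lemma discrete_deriv_const_zero: "discrete_deriv (Suc k) (\<lambda>_. c) = (\<lambda>_. 0)"
  by (induction k) (simp_all add: fun_eq_iff)

lemma discrete_deriv_bounded:
  assumes "\<And>n. \<bar>f n\<bar> \<le> b"
  shows "\<bar>discrete_deriv k f n\<bar> \<le> 2 ^ k * b"
proof (induction k arbitrary: n)
  case (Suc k)
  show ?case
    using Suc[of n] Suc[of "n + 1"] by simp
qed (use assms in simp)

lemma bounded_linear_growth_zero:
  fixes g :: "int \<Rightarrow> real"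
  assumes bound: "\<And>n. \<bar>g n\<bar> \<le> b" and step: "\<And>n. g (n + 1) - g n = c"
  shows "c = 0"
proof (rule ccontr)
  assume "c \<noteq> 0"
  have lin: "g (int m) = g 0 + real m * c" for m
  proof (induction m)
    case (Suc m)
    then show ?case using step[of "int m"] by (simp add: algebra_simps)
  qed simp
  obtain m :: nat where "2 * b < real m * \<bar>c\<bar>"
    using \<open>c \<noteq> 0\<close> reals_Archimedean3[of "\<bar>c\<bar>"] by auto
  moreover have "real m * \<bar>c\<bar> = \<bar>g (int m) - g 0\<bar>"
    using lin[of m] by (simp add: abs_mult)
  ultimately show False
    using bound[of "int m"] bound[of 0] by linarith
qed

lemma discrete_deriv_zero_const:
  assumes bound: "\<And>n. \<bar>f n\<bar> \<le> b" and "\<And>n. discrete_deriv (Suc k) f n = 0"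
  shows "\<exists>c. f = (\<lambda>_. c)"
  using assms(2)
proof (induction k)
  case 0
  have step: "f (n + 1) = f n" for n
    using 0[of n] by simp
  have "f n = f 0" for n
    by (induction n rule: int_induct[where k = 0]) (use step in \<open>simp_all, metis diff_add_cancel\<close>)
  then show ?case by blast
next
  case (Suc k)
  define g where "g = discrete_deriv (Suc k) f"
  have step: "g (n + 1) = g n" for n
    using Suc.prems[of n] by (simp add: g_def)
  have g: "g n = g 0" for n
    by (induction n rule: int_induct[where k = 0]) (use step in \<open>simp_all, metis diff_add_cancel\<close>)
  have "g 0 = 0"
  proof (rule bounded_linear_growth_zero)
    show "\<bar>discrete_deriv k f n\<bar> \<le> 2 ^ k * b" for n
      by (rule discrete_deriv_bounded[OF bound])
    show "discrete_deriv k f (n + 1) - discrete_deriv k f n = g 0" for n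
      using g[of n] by (simp add: g_def)
  qed
  then show ?case
    using Suc.IH g by (simp add: g_def)
qed

lemma lp_norm_zero: "lp_norm p (\<lambda>_. 0) = 0"
  by (simp add: lp_norm_def)

lemma lp_norm_eq_0D:
  assumes "lp_norm p f = 0"
  shows "f n = 0"
proof (cases "p = \<infinity>")
  case True
  then have "(SUP n. ennreal \<bar>f n\<bar>) = 0"
    using assms by (simp add: lp_norm_def)
  then have "ennreal \<bar>f n\<bar> \<le> 0"
    by (metis SUP_upper UNIV_I)
  then show ?thesis by simp
next
  case False
  define h where "h = (\<lambda>n. \<bar>f n\<bar> powr enn2real p)"
  have sm: "h summable_on UNIV"
    using assms False by (auto simp: lp_norm_def h_def split: if_splits)
  then have "ennreal (infsum h UNIV powr (1 / enn2real p)) = 0"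
    using assms False by (simp add: lp_norm_def h_def)
  then have "infsum h UNIV \<le> 0"
    by (simp add: ennreal_eq_0_iff)
  then have "h n = 0"
    by (rule nonneg_infsum_le_0D) (use sm in \<open>auto simp: h_def\<close>)
  then show ?thesis by (simp add: h_def)
qed

lemma best_const_least:
  shows "admissible_const k p (best_const k p)"
    and "admissible_const k p C \<Longrightarrow> best_const k p \<le> C"
proof -
  show "admissible_const k p C \<Longrightarrow> best_const k p \<le> C"
    by (auto simp: best_const_def intro: Inf_lower)
  show "admissible_const k p (best_const k p)"
    unfolding admissible_const_def
  proof (intro allI impI)
    fix S :: "int set"
    let ?f = "indicat_real S"
    assume fin: "lp_norm p (discrete_deriv k ?f) < \<infinity>"
    show "lp_norm p (discrete_deriv k (maximal_fun ?f))
            \<le> best_const k p * lp_norm p (discrete_deriv k ?f)"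
    proof (cases "lp_norm p (discrete_deriv k ?f) = 0")
      case False
      show ?thesis
        unfolding best_const_def
        by (rule INF_mult_bound_ennreal) (use False fin in \<open>auto simp: admissible_const_def\<close>)
    next
      case True
      have zero: "discrete_deriv k ?f n = 0" for n
        using True by (rule lp_norm_eq_0D)
      have "discrete_deriv k (maximal_fun ?f) = (\<lambda>_. 0)"
      proof (cases k)
        case 0
        then have "maximal_fun ?f n = \<bar>0\<bar>" for n
          using zero by (intro maximal_fun_const) simp
        then show ?thesis using 0 by auto
      next
        case (Suc j)
        have "\<bar>?f n\<bar> \<le> 1" for n by (simp add: indicator_def)
        then obtain c where "?f = (\<lambda>_. c)"
          using discrete_deriv_zero_const[of ?f 1 j] zero Suc by blast
        then have "maximal_fun ?f = (\<lambda>_. \<bar>c\<bar>)"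
          using maximal_fun_const[of ?f c] by (intro ext) simp
        then show ?thesis by (simp add: Suc discrete_deriv_const_zero del: discrete_deriv.simps)
      qed
      then show ?thesis by (simp add: lp_norm_zero)
    qed
  qed
qed

text \<open>The case \<open>m = 0\<close> is a convention which extends the recursion to all natural numbers.\<close>

primrec B_seq :: "nat \<Rightarrow> int set" where
  "B_seq 0 = {}"
| "B_seq (Suc m) = B_seq m \<union> (\<lambda>b. b + 8 * int m) ` {0, 1, 2, 5}"

lemma B_seq_1: "B_seq 1 = {0, 1, 2, 5}"
  by simp

lemma B_seq_step: "m \<ge> 1 \<Longrightarrow> B_seq (m + 1) = B_seq m \<union> (\<lambda>b. b + 8 * int m) ` B_seq 1"
  by simp

end

(* On the 8-periodic set {0,1,2,5} + 8Z the maximal function is again 8-periodic, with values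
   1, 1, 1, 3/4, 2/3, 1, 2/3, 3/4 on a period. The Fourier coefficient of the characteristic
   function at the frequency 4 vanishes, so that its k-th difference grows like |1 + e^(pi i/4)|^k,
   while the one of the maximal function does not vanish, so that its k-th difference grows like 2^k.
   Parseval's identity makes this an l^2 inequality on a period with the constant 1/12, and
   comparing the l^p norm with the l^2 norm on the 8 points of a period costs 8^|1/p - 1/2|.
   For finite p, the set B_m differs from the periodic set by boundary effects which are bounded
   in m, whereas the norms grow like m^(1/p). For p = infinity, where boundary effects do not
   average out, the periodic set itself is used. *)

theory Submission
  imports Defs
begin

section \<open>Discrete derivatives of periodic functions\<close>

text \<open>Locality: the derivative at \<open>n\<close> sees only the stencil from \<open>n\<close>
  to \<open>n + k\<close>, so truncating a set disturbs only \<open>k\<close> points per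
  boundary.\<close>

lemma discrete_deriv_cong:
  assumes "\<And>i. n \<le> i \<Longrightarrow> i \<le> n + int k \<Longrightarrow> f i = g i"
  shows "discrete_deriv k f n = discrete_deriv k g n"
  using assms
proof (induction k arbitrary: n)
  case (Suc k)
  have "discrete_deriv k f (n + 1) = discrete_deriv k g (n + 1)"
    by (rule Suc.IH) (use Suc.prems in auto)
  moreover have "discrete_deriv k f n = discrete_deriv k g n"
    by (rule Suc.IH) (use Suc.prems in auto)
  ultimately show ?case
    by simp
qed simp

lemma discrete_deriv_zero: "discrete_deriv k (\<lambda>_. 0) n = 0"
  by (induction k arbitrary: n) simp_all

lemma discrete_deriv_shift_invariant:
  assumes "\<And>n. f (n + s) = f n"
  shows "discrete_deriv k f (n + s) = discrete_deriv k f n"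
proof (induction k arbitrary: n)
  case (Suc k)
  show ?case
    using Suc[of n] Suc[of "n + 1"] by (simp add: algebra_simps)
qed (simp add: assms)

text \<open>The squared \<open>\<ell>\<^sup>2\<close> norm of a derivative is the autocorrelation at lag \<open>0\<close>. The lags \<open>0\<close> to
  \<open>4\<close> evolve linearly under taking differences, and the weights \<open>w0\<close> to \<open>w4\<close> in
  \<open>corr_discrete_deriv\<close> are the parts of the energy at the frequencies \<open>0\<close> to \<open>4\<close> of the group
  of integers modulo \<open>8\<close>.\<close>

definition corr :: "(int \<Rightarrow> real) \<Rightarrow> int \<Rightarrow> real" where
  "corr g j = (\<Sum>n\<in>{0..<8}. g n * g (n + j))"

lemma atLeastLessThan_8: "{0..<8::int} = {0, 1, 2, 3, 4, 5, 6, 7}"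
  by auto

text \<open>Expanding the product gives c(j) -> 2 c(j) - c(j-1) - c(j+1). The autocorrelation c is
  even and 8-periodic, so c(-1) = c(1) and c(5) = c(3) close the system on five lags.\<close>

lemma corr_difference:
  fixes g :: "int \<Rightarrow> real"
  assumes per: "\<And>n. g (n + 8) = g n"
  defines "h \<equiv> \<lambda>n. g (n + 1) - g n"
  shows "corr h 0 = 2 * corr g 0 - 2 * corr g 1"
    and "corr h 1 = 2 * corr g 1 - corr g 0 - corr g 2"
    and "corr h 2 = 2 * corr g 2 - corr g 1 - corr g 3"
    and "corr h 3 = 2 * corr g 3 - corr g 2 - corr g 4"
    and "corr h 4 = 2 * corr g 4 - 2 * corr g 3"
proof -
  have "g 8 = g 0" "g 9 = g 1" "g 10 = g 2" "g 11 = g 3" "g 12 = g 4"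
    using per[of 0] per[of 1] per[of 2] per[of 3] per[of 4] by simp_all
  note [simp] = this
  show "corr h 0 = 2 * corr g 0 - 2 * corr g 1"
    and "corr h 1 = 2 * corr g 1 - corr g 0 - corr g 2"
    and "corr h 2 = 2 * corr g 2 - corr g 1 - corr g 3"
    and "corr h 3 = 2 * corr g 3 - corr g 2 - corr g 4"
    and "corr h 4 = 2 * corr g 4 - 2 * corr g 3"
    by (simp_all add: h_def corr_def atLeastLessThan_8 algebra_simps)
qed

text \<open>The vectors cos(pi l j / 4), l = 0, ..., 4, diagonalise the recursion of
  \<open>corr_difference\<close>, with eigenvalues 2 - 2 cos(pi l / 4) = |e^(pi i l / 4) - 1|^2. The
  hypotheses expand the autocorrelation of \<open>g\<close> in them, which replaces complex Fourier
  coefficients.\<close>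

lemma corr_discrete_deriv:
  fixes g :: "int \<Rightarrow> real" and w0 w1 w2 w3 w4 :: real
  assumes per: "\<And>n. g (n + 8) = g n"
    and "corr g 0 = w0 + w1 + w2 + w3 + w4"
    and "corr g 1 = w0 + sqrt 2 / 2 * (w1 - w3) - w4"
    and "corr g 2 = w0 - w2 + w4"
    and "corr g 3 = w0 - sqrt 2 / 2 * (w1 - w3) - w4"
    and "corr g 4 = w0 - w1 + w2 - w3 + w4"
  shows "corr (discrete_deriv k g) 0 =
    w0 * 0 ^ k + w1 * (2 - sqrt 2) ^ k + w2 * 2 ^ k + w3 * (2 + sqrt 2) ^ k + w4 * 4 ^ k"
proof -
  \<comment> \<open>All five lags go through the induction, since each one depends on its
    neighbours.\<close>
  have "corr (discrete_deriv k g) 0 = w0 * 0 ^ k + w1 * (2 - sqrt 2) ^ k + w2 * 2 ^ k + w3 * (2 + sqrt 2) ^ k + w4 * 4 ^ k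
    \<and> corr (discrete_deriv k g) 1 = w0 * 0 ^ k + sqrt 2 / 2 * (w1 * (2 - sqrt 2) ^ k - w3 * (2 + sqrt 2) ^ k) - w4 * 4 ^ k
    \<and> corr (discrete_deriv k g) 2 = w0 * 0 ^ k - w2 * 2 ^ k + w4 * 4 ^ k
    \<and> corr (discrete_deriv k g) 3 = w0 * 0 ^ k - sqrt 2 / 2 * (w1 * (2 - sqrt 2) ^ k - w3 * (2 + sqrt 2) ^ k) - w4 * 4 ^ k
    \<and> corr (discrete_deriv k g) 4 = w0 * 0 ^ k - w1 * (2 - sqrt 2) ^ k + w2 * 2 ^ k - w3 * (2 + sqrt 2) ^ k + w4 * 4 ^ k"
  proof (induction k)
    case 0
    show ?case using assms by simp
  next
    case (Suc k)
    have s: "sqrt 2 * (sqrt 2 * x) = 2 * x" for x :: real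
      by (simp flip: mult.assoc)
    show ?case
      unfolding discrete_deriv.simps
        corr_difference[of "discrete_deriv k g", OF discrete_deriv_shift_invariant[of g 8, OF per]]
      using Suc by (simp add: algebra_simps s)
  qed
  then show ?thesis by simp
qed

section \<open>The periodic set and its maximal function\<close>

definition per_set :: "int set" where
  "per_set = {n. n mod 8 \<in> {0, 1, 2, 5}}"

definition per_max :: "int \<Rightarrow> real" where
  "per_max n = [1, 1, 1, 3/4, 2/3, 1, 2/3, 3/4] ! nat (n mod 8)"

lemma indicat_per_set: "indicat_real per_set n = [1, 1, 1, 0, 0, 1, 0, 0] ! nat (n mod 8)"
proof -
  define r where "r = n mod 8"
  have "r \<in> {0..<8}" by (simp add: r_def)
  then show ?thesis
    unfolding atLeastLessThan_8 per_set_def indicator_def mem_Collect_eq r_def[symmetric] by auto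
qed

lemma per_set_shift: "indicat_real per_set (n + 8) = indicat_real per_set n"
  by (simp add: indicat_per_set)

lemma per_max_shift: "per_max (n + 8) = per_max n"
  by (simp add: per_max_def)

section \<open>Energy of the derivatives on one period\<close>

lemma corr_per_set:
  "corr (discrete_deriv k (indicat_real per_set)) 0 =
     2 * 0 ^ k + 1/2 * (2 - sqrt 2) ^ k + 1 * 2 ^ k + 1/2 * (2 + sqrt 2) ^ k + 0 * 4 ^ k"
  by (rule corr_discrete_deriv[of "indicat_real per_set"])
    (simp_all add: per_set_shift corr_def atLeastLessThan_8 indicat_per_set)

text \<open>The weight of \<open>4 ^ k\<close> is the squared alternating sum over a period, divided
  by 8: here (-1/6)^2 / 8. For \<open>per_set\<close> it is 0, since 0, 2 are even and 1, 5 are odd,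
  which leaves \<open>2 + sqrt 2\<close> as the largest growth rate.\<close>

lemma corr_per_max:
  "corr (discrete_deriv k per_max) 0 =
     1681/288 * 0 ^ k + 1/18 * (2 - sqrt 2) ^ k + 1/16 * 2 ^ k + 1/18 * (2 + sqrt 2) ^ k + 1/288 * 4 ^ k"
  by (rule corr_discrete_deriv[of per_max])
    (simp_all add: per_max_shift corr_def atLeastLessThan_8 per_max_def)

text \<open>The factor 144 is (1/2) / (1/288), which makes the terms in 4^k (2 + sqrt 2)^k equal on
  both sides. For k > 0 the rest of the left side, in (4 (2 - sqrt 2))^k and 8^k, is dominated by
  the terms in (2 (2 + sqrt 2))^k and (2 + sqrt 2)^(2k). The frequency 0 contributes only for k =
  0.\<close>

lemma corr_ratio:
  "4 ^ k * corr (discrete_deriv k (indicat_real per_set)) 0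
     \<le> 144 * (2 + sqrt 2) ^ k * corr (discrete_deriv k per_max) 0"
proof (cases "k = 0")
  case True
  then show ?thesis
    unfolding corr_per_set corr_per_max using real_sqrt_ge_one[of 2] by (simp add: algebra_simps)
next
  case False
  define x :: real where "x = sqrt 2"
  have s: "1 < x" "x < 2" "x * x = 2"
    by (simp_all add: x_def real_less_lsqrt)
  let ?a = "2 - x" and ?b = "2 + x"
  have "(4 * ?a) ^ k \<le> (2 * ?b) ^ k"
    using s by (intro power_mono) auto
  moreover have "(4 * 2) ^ k \<le> 8 * (?b * ?b) ^ k"
  proof -
    have "(4 * 2) ^ k \<le> (?b * ?b) ^ k"
      using s by (intro power_mono) (auto simp: algebra_simps)
    moreover have "0 \<le> (?b * ?b) ^ k"
      using s by simp
    ultimately show ?thesis by linarith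
  qed
  moreover have "0 \<le> ?b ^ k * ?a ^ k" "0 \<le> ?b ^ k * 2 ^ k"
    using s by auto
  ultimately show ?thesis
    unfolding corr_per_set corr_per_max power_mult_distrib x_def[symmetric] using False
    by (simp add: algebra_simps power_0_left)
qed

lemma corr_pos:
  "0 < corr (discrete_deriv k (indicat_real per_set)) 0"
  "0 < corr (discrete_deriv k per_max) 0"
proof -
  have "sqrt 2 < (2::real)"
    by (simp add: real_less_lsqrt)
  then have "0 < (2 - sqrt 2) ^ k" "0 < (2 + sqrt 2) ^ k"
    by (simp_all add: add_pos_pos)
  moreover have "0 \<le> (0::real) ^ k" "0 < (2::real) ^ k" "0 < (4::real) ^ k"
    by simp_all
  ultimately show "0 < corr (discrete_deriv k (indicat_real per_set)) 0"
    "0 < corr (discrete_deriv k per_max) 0"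
    unfolding corr_per_set corr_per_max by linarith+
qed

text \<open>\<open>2 + sqrt 2\<close> is the eigenvalue at the frequency 3, and e^(3 pi i/4) - 1 is
  minus the conjugate of 1 + e^(pi i/4).\<close>

lemma cmod_one_plus_exp: "(cmod (1 + exp (pi * \<i> / 4)))\<^sup>2 = 2 + sqrt 2"
proof -
  have e: "exp (pi * \<i> / 4) = Complex (sqrt 2 / 2) (sqrt 2 / 2)"
    using cis_conv_exp[of "pi / 4"]
    by (simp add: mult.commute cis.ctr cos_45 sin_45)
  show ?thesis
    unfolding e cmod_power2 by (simp add: power2_eq_square algebra_simps)
qed

text \<open>\<open>disc\<close> is twice the partial sum of the periodic sequence \<open>1\<^bsub>per_set\<^esub> - 1/2\<close>.\<close>

definition disc :: "int \<Rightarrow> int" where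
  "disc n = [0, 1, 2, 3, 2, 1, 2, 1] ! nat (n mod 8)"

text \<open>The density 1/2 yields the length and the rest telescopes, so a sum depends only on the
  length and the residues of the endpoints. The factor 2 keeps everything integral.\<close>

lemma sum_per_set:
  assumes "a \<le> b"
  shows "2 * (\<Sum>i\<in>{a..b}. indicat_real per_set i) = real_of_int (b + 1 - a + disc (b + 1) - disc a)"
proof -
  have step: "2 * indicat_real per_set n = real_of_int (1 + disc (n + 1) - disc n)" for n
  proof -
    define r where "r = n mod 8"
    have next_mod: "(n + 1) mod 8 = (r + 1) mod 8"
      by (simp add: r_def mod_simps)
    have "r \<in> {0..<8}" by (simp add: r_def)
    then show ?thesis
      unfolding atLeastLessThan_8 disc_def next_mod per_set_def indicator_def mem_Collect_eq r_def[symmetric]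
      by auto
  qed
  from assms show ?thesis
  proof (induction b rule: int_ge_induct)
    case base
    show ?case using step[of a] by simp
  next
    case (step b)
    have "{a..b + 1} = insert (b + 1) {a..b}"
      using step.hyps by auto
    then show ?case
      using step.IH \<open>\<And>n. 2 * indicat_real per_set n = _\<close>[of "b + 1"] by (simp add: algebra_simps)
  qed
qed

text \<open>Finite check by evaluation: \<open>a\<close> stands for the residue of the left
  endpoint, \<open>l + 1\<close> for the length, \<open>d\<close> for the position of the point in
  the interval. The factor 12 clears the denominators of \<open>per_max\<close>.\<close>

lemma per_max_upper_short:
  "\<forall>a\<in>set [0..7]. \<forall>l\<in>set [0..7]. \<forall>d\<in>set [0..l].
     12 * ((l + 1) + disc (a + l + 1) - disc a)
       \<le> 2 * [12, 12, 12, 9, 8, 12, 8, 9] ! nat ((a + d) mod 8) * (l + 1)"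
  by code_simp

lemma disc_range: "disc n \<in> {0..3}"
proof -
  have "n mod 8 \<in> {0..<8}" by simp
  then show ?thesis
    unfolding atLeastLessThan_8 by (auto simp: disc_def)
qed

lemma per_max_range: "2/3 \<le> per_max n" "per_max n \<le> 1"
proof -
  have "n mod 8 \<in> {0..<8}" by simp
  then show "2/3 \<le> per_max n" "per_max n \<le> 1"
    unfolding atLeastLessThan_8 by (auto simp: per_max_def)
qed

lemma per_max_numerator:
  "12 * per_max n = real_of_int ([12, 12, 12, 9, 8, 12, 8, 9] ! nat (n mod 8))"
proof -
  have "n mod 8 \<in> {0..<8}" by simp
  then show ?thesis
    unfolding atLeastLessThan_8 by (auto simp: per_max_def)
qed

lemma sum_per_set_le:
  assumes "a \<le> n" "n \<le> b"
  shows "(\<Sum>i\<in>{a..b}. indicat_real per_set i) \<le> per_max n * real_of_int (b + 1 - a)"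
proof -
  have "real_of_int (b + 1 - a + disc (b + 1) - disc a) \<le> 2 * per_max n * real_of_int (b + 1 - a)"
  proof (cases "b - a \<le> 7") \<comment> \<open>for length at least 9, the average is at most 2/3 as \<open>disc\<close> ranges over 0 to 3\<close>
    case True
    define \<alpha> l d where "\<alpha> = a mod 8" and "l = b - a" and "d = n - a"
    have "\<alpha> \<in> set [0..7]" "l \<in> set [0..7]" "d \<in> set [0..l]"
      using True assms pos_mod_sign[of 8 a] pos_mod_bound[of 8 a] by (auto simp: \<alpha>_def l_def d_def)
    then have "12 * ((l + 1) + disc (\<alpha> + l + 1) - disc \<alpha>)
       \<le> 2 * [12, 12, 12, 9, 8, 12, 8, 9] ! nat ((\<alpha> + d) mod 8) * (l + 1)"
      using per_max_upper_short by blast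
    moreover have "disc (\<alpha> + l + 1) = disc (b + 1)" "disc \<alpha> = disc a" "(\<alpha> + d) mod 8 = n mod 8"
      using mod_add_left_eq[of a 8 "b - a + 1"] mod_add_left_eq[of a 8 "n - a"]
      by (simp_all add: disc_def \<alpha>_def l_def d_def algebra_simps)
    ultimately have "12 * (b + 1 - a + disc (b + 1) - disc a)
       \<le> 2 * [12, 12, 12, 9, 8, 12, 8, 9] ! nat (n mod 8) * (b + 1 - a)"
      by (simp add: l_def algebra_simps)
    then have "12 * real_of_int (b + 1 - a + disc (b + 1) - disc a)
       \<le> 2 * (12 * per_max n) * real_of_int (b + 1 - a)"
      unfolding per_max_numerator by (metis of_int_le_iff of_int_mult of_int_numeral)
    then show ?thesis by simp
  next
    case False
    have "real_of_int (b + 1 - a + disc (b + 1) - disc a) \<le> 4 / 3 * real_of_int (b + 1 - a)"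
      using False disc_range[of a] disc_range[of "b + 1"] by simp
    also have "\<dots> \<le> 2 * per_max n * real_of_int (b + 1 - a)"
      using False per_max_range[of n] by (intro mult_right_mono) auto
    finally show ?thesis .
  qed
  then show ?thesis
    using sum_per_set[of a b] assms by simp
qed

text \<open>The window matters later: an optimal interval fits into the period of \<open>n\<close>
  and the first three points of the next one.\<close>

lemma per_max_attained:
  "\<exists>a b. 8 * (n div 8) \<le> a \<and> a \<le> n \<and> n \<le> b \<and> b \<le> 8 * (n div 8) + 10 \<and>
     (\<Sum>i\<in>{a..b}. indicat_real per_set i) = per_max n * real_of_int (b + 1 - a)"
proof -
  define r where "r = n mod 8"
  \<comment> \<open>Intervals by residue: a point of the set alone; for 3 and 4 an interval starting
    at 0; for 6 and 7 an interval ending at 10, where the run 8, 9, 10 of the set ends.\<close>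
  define w :: "int \<times> int" where
    "w = [(0, 0), (1, 1), (2, 2), (0, 3), (0, 5), (5, 5), (5, 10), (7, 10)] ! nat r"
  define j where "j = n div 8"
  define a b where "a = 8 * j + fst w" and "b = 8 * j + snd w"
  have n: "n = 8 * j + r" by (simp add: r_def j_def)
  have pm: "per_max n = [1, 1, 1, 3/4, 2/3, 1, 2/3, 3/4] ! nat r"
    by (simp add: per_max_def r_def)
  have ab: "disc a = disc (fst w)" "disc (b + 1) = disc (snd w + 1)" "b - a = snd w - fst w"
    by (simp_all add: disc_def a_def b_def add.assoc)
  have "r \<in> {0..<8}" by (simp add: r_def)
  then have w: "0 \<le> fst w \<and> fst w \<le> r \<and> r \<le> snd w \<and> snd w \<le> 10 \<and>
     real_of_int (snd w - fst w + 1 + disc (snd w + 1) - disc (fst w))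
       = 2 * per_max n * real_of_int (snd w - fst w + 1)"
    unfolding atLeastLessThan_8 pm w_def disc_def by auto
  then have le: "8 * j \<le> a" "a \<le> n" "n \<le> b" "b \<le> 8 * j + 10"
    unfolding n a_def b_def by simp_all
  have len: "b + 1 - a = snd w - fst w + 1"
    using ab(3) by linarith
  have "2 * (\<Sum>i\<in>{a..b}. indicat_real per_set i) = real_of_int (b + 1 - a + disc (b + 1) - disc a)"
    using le(2,3) by (intro sum_per_set) (rule order_trans)
  also have "b + 1 - a + disc (b + 1) - disc a = snd w - fst w + 1 + disc (snd w + 1) - disc (fst w)"
    unfolding ab(1,2) len ..
  also have "real_of_int \<dots> = 2 * per_max n * real_of_int (snd w - fst w + 1)"
    using w by blast
  finally have "(\<Sum>i\<in>{a..b}. indicat_real per_set i) = per_max n * real_of_int (b + 1 - a)"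
    unfolding len by simp
  then show ?thesis
    using le unfolding j_def by blast
qed

text \<open>Averages over \<open>S\<close> are at most those over \<open>per_set\<close>, and the
  window in the second hypothesis contains an optimal interval. This serves the truncated sets and
  \<open>per_set\<close> alike.\<close>

lemma maximal_fun_indicat_eq_per_max:
  assumes "S \<subseteq> per_set"
    and "\<And>i. 8 * (n div 8) \<le> i \<Longrightarrow> i \<le> 8 * (n div 8) + 10 \<Longrightarrow> i \<in> per_set \<Longrightarrow> i \<in> S"
  shows "maximal_fun (indicat_real S) n = per_max n"
proof -
  let ?avg = "\<lambda>I. (\<Sum>i\<in>I. \<bar>indicat_real S i\<bar>) / real (card I)"
  let ?J = "{I \<in> int_intervals. n \<in> I}"
  have upper: "?avg I \<le> per_max n" if "I \<in> ?J" for I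
  proof -
    have "I \<in> int_intervals" "n \<in> I"
      using that by auto
    then obtain a b where I: "I = {a..b}" "a \<le> n" "n \<le> b"
      unfolding int_intervals_def by auto
    have "(\<Sum>i\<in>I. \<bar>indicat_real S i\<bar>) \<le> (\<Sum>i\<in>{a..b}. indicat_real per_set i)"
      unfolding I(1) using assms(1) by (intro sum_mono) (auto simp: indicator_def)
    also have "\<dots> \<le> per_max n * real_of_int (b + 1 - a)"
      using I by (intro sum_per_set_le)
    also have "real_of_int (b + 1 - a) = real (card I)"
      using I by simp
    finally show ?thesis
      using I by (simp add: divide_le_eq)
  qed
  obtain a b where ab: "8 * (n div 8) \<le> a" "a \<le> n" "n \<le> b" "b \<le> 8 * (n div 8) + 10"
    and sum: "(\<Sum>i\<in>{a..b}. indicat_real per_set i) = per_max n * real_of_int (b + 1 - a)"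
    using per_max_attained by blast
  have "i \<in> S \<longleftrightarrow> i \<in> per_set" if "i \<in> {a..b}" for i
    using assms(1) assms(2)[of i] order_trans[OF ab(1), of i] order_trans[OF _ ab(4), of i] that
    by (auto simp only: atLeastAtMost_iff)
  then have "(\<Sum>i\<in>{a..b}. \<bar>indicat_real S i\<bar>) = (\<Sum>i\<in>{a..b}. indicat_real per_set i)"
    by (intro sum.cong) (simp_all add: indicator_def)
  then have "?avg {a..b} = per_max n"
    using sum order_trans[OF ab(2,3)] by (simp add: divide_eq_eq)
  moreover have J: "{a..b} \<in> ?J"
  proof -
    have "{a..b} \<in> int_intervals"
      using order_trans[OF ab(2,3)] unfolding int_intervals_def by blast
    then show ?thesis using ab(2,3) by simp
  qed
  ultimately have "per_max n \<in> ?avg ` ?J"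
    by (intro rev_image_eqI[OF J]) simp
  then show ?thesis
    unfolding maximal_fun_def by (rule cSup_eq_maximum) (use upper in blast)
qed

section \<open>The truncated sets and their maximal functions\<close>

lemma B_seq_eq: "B_seq m = per_set \<inter> {0..<8 * int m}"
proof (induction m)
  case (Suc m)
  have iff: "i \<in> (\<lambda>b. b + 8 * int m) ` {0, 1, 2, 5} \<longleftrightarrow> i \<in> per_set \<and> 8 * int m \<le> i \<and> i < 8 * int m + 8" for i
  proof
    assume "i \<in> per_set \<and> 8 * int m \<le> i \<and> i < 8 * int m + 8"
    then have "i - 8 * int m = i mod 8" "i mod 8 \<in> {0, 1, 2, 5}"
      by (auto simp: per_set_def) presburger+
    then show "i \<in> (\<lambda>b. b + 8 * int m) ` {0, 1, 2, 5}"
      by (intro image_eqI[of _ _ "i - 8 * int m"]) auto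
  qed (auto simp: per_set_def mod_simps)
  have block: "(\<lambda>b. b + 8 * int m) ` {0, 1, 2, 5} = per_set \<inter> {8 * int m..<8 * int m + 8}"
    by (rule set_eqI) (simp only: iff Int_iff atLeastLessThan_iff)
  show ?case
    unfolding B_seq.simps Suc.IH block by auto
qed (simp add: per_set_def)

text \<open>The last block is left out because an optimal interval may reach into the following
  block.\<close>

lemma maximal_fun_B_seq:
  assumes "0 \<le> n" "n < 8 * (int m - 1)"
  shows "maximal_fun (indicat_real (B_seq m)) n = per_max n"
proof (rule maximal_fun_indicat_eq_per_max)
  have "0 \<le> n div 8" "n div 8 < int m - 1"
    using assms by auto
  then show "i \<in> B_seq m"
    if "8 * (n div 8) \<le> i" "i \<le> 8 * (n div 8) + 10" "i \<in> per_set" for i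
    using that by (simp add: B_seq_eq)
qed (simp add: B_seq_eq)

lemma maximal_fun_per_set: "maximal_fun (indicat_real per_set) = per_max"
  by (intro ext maximal_fun_indicat_eq_per_max) auto

section \<open>Comparison of norms on finite sets\<close>

lemma divide_left_mono_ennreal:
  fixes a b c :: ennreal
  assumes "b \<le> c"
  shows "a / c \<le> a / b"
proof -
  have "inverse c \<le> inverse b"
  \<comment> \<open>In the exceptional cases \<open>inverse b\<close> is infinite or
    \<open>inverse c\<close> is 0; otherwise both numbers are positive reals.\<close>
  proof (cases "b = 0 \<or> c = top")
    case False
    then obtain x y where "b = ennreal x" "c = ennreal y" "0 < x"
      using assms by (cases b; cases c) (auto simp: top_unique less_le)
    then show ?thesis
      using assms by (auto simp: inverse_ennreal ennreal_le_iff2 intro!: ennreal_leI le_imp_inverse_le)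
  qed auto
  then show ?thesis
    unfolding divide_ennreal_def by (rule mult_left_mono) simp
qed

text \<open>Jensen's inequality for the convex function t^r with equal weights; vanishing entries
  are treated in \<open>powr_mean_le\<close>.\<close>

lemma powr_mean_le_positive:
  fixes x :: "'a \<Rightarrow> real"
  assumes "finite A" "A \<noteq> {}" "1 \<le> r" "\<And>i. i \<in> A \<Longrightarrow> 0 < x i"
  shows "(\<Sum>i\<in>A. x i) powr r \<le> real (card A) powr (r - 1) * (\<Sum>i\<in>A. x i powr r)"
proof -
  define N where "N = real (card A)"
  have N: "0 < N"
    using assms by (simp add: N_def card_gt_0_iff)
  have "(\<Sum>i\<in>A. (1 / N) *\<^sub>R x i) powr r \<le> (\<Sum>i\<in>A. (1 / N) * (x i powr r))"
    by (rule convex_on_sum[OF assms(1,2) powr_convex[OF assms(3)]])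
      (use assms N in \<open>auto simp: N_def\<close>)
  then have "(\<Sum>i\<in>A. x i) powr r / N powr r \<le> (\<Sum>i\<in>A. x i powr r) / N"
    using N assms by (simp add: powr_divide sum_nonneg less_imp_le flip: sum_divide_distrib)
  then show ?thesis
    using N by (simp add: powr_diff field_simps flip: N_def)
qed

text \<open>Vanishing entries add nothing to either sum, and dropping them only lowers the
  cardinality factor, as r - 1 >= 0.\<close>

lemma powr_mean_le:
  fixes x :: "'a \<Rightarrow> real"
  assumes "finite A" "1 \<le> r" "\<And>i. i \<in> A \<Longrightarrow> 0 \<le> x i"
  shows "(\<Sum>i\<in>A. x i) powr r \<le> real (card A) powr (r - 1) * (\<Sum>i\<in>A. x i powr r)"
proof -
  define P where "P = {i\<in>A. x i \<noteq> 0}"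
  have P: "finite P" "P \<subseteq> A"
    using assms by (auto simp: P_def)
  have sums: "(\<Sum>i\<in>A. x i) = (\<Sum>i\<in>P. x i)" "(\<Sum>i\<in>A. x i powr r) = (\<Sum>i\<in>P. x i powr r)"
    using assms P by (auto intro!: sum.mono_neutral_right simp: P_def)
  show ?thesis
  proof (cases "P = {}")
    case False
    have "(\<Sum>i\<in>P. x i) powr r \<le> real (card P) powr (r - 1) * (\<Sum>i\<in>P. x i powr r)"
      by (rule powr_mean_le_positive[OF P(1) False assms(2)])
        (use assms(3) in \<open>force simp: P_def\<close>)
    also have "\<dots> \<le> real (card A) powr (r - 1) * (\<Sum>i\<in>P. x i powr r)"
      using assms P card_mono[OF assms(1) P(2)] by (intro mult_right_mono powr_mono2 sum_nonneg) auto
    finally show ?thesis by (simp add: sums)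
  qed (simp add: sums)
qed

text \<open>With s the total, x^r = x * x^(r-1) <= x * s^(r-1) for each entry x.\<close>

lemma sum_powr_le_powr_sum:
  fixes x :: "'a \<Rightarrow> real"
  assumes "finite A" "1 \<le> r" "\<And>i. i \<in> A \<Longrightarrow> 0 \<le> x i"
  shows "(\<Sum>i\<in>A. x i powr r) \<le> (\<Sum>i\<in>A. x i) powr r"
proof -
  let ?s = "\<Sum>i\<in>A. x i"
  have split: "y powr r = y * y powr (r - 1)" if "0 \<le> y" for y :: real
    using that by (cases "y = 0") (simp_all add: powr_diff)
  have "x i powr r \<le> x i * ?s powr (r - 1)" if "i \<in> A" for i
    using assms that unfolding split[OF assms(3)[OF that]]
    by (intro mult_left_mono powr_mono2 member_le_sum) auto
  then have "(\<Sum>i\<in>A. x i powr r) \<le> ?s * ?s powr (r - 1)"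
    unfolding sum_distrib_right by (intro sum_mono)
  then show ?thesis
    using assms split[of ?s] by (simp add: sum_nonneg)
qed

lemma lp_mono_exponent:
  fixes x :: "'a \<Rightarrow> real"
  assumes "finite A" "0 < s" "s \<le> t"
  shows "(\<Sum>i\<in>A. \<bar>x i\<bar> powr t) powr (1 / t) \<le> (\<Sum>i\<in>A. \<bar>x i\<bar> powr s) powr (1 / s)"
proof -
  have "(\<Sum>i\<in>A. (\<bar>x i\<bar> powr s) powr (t / s)) \<le> (\<Sum>i\<in>A. \<bar>x i\<bar> powr s) powr (t / s)"
    using assms by (intro sum_powr_le_powr_sum) auto
  then have "(\<Sum>i\<in>A. \<bar>x i\<bar> powr t) \<le> (\<Sum>i\<in>A. \<bar>x i\<bar> powr s) powr (t / s)"
    using assms by (simp add: powr_powr)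
  then have "(\<Sum>i\<in>A. \<bar>x i\<bar> powr t) powr (1 / t) \<le> ((\<Sum>i\<in>A. \<bar>x i\<bar> powr s) powr (t / s)) powr (1 / t)"
    using assms by (intro powr_mono2 sum_nonneg) auto
  then show ?thesis
    using assms by (simp add: powr_powr)
qed

text \<open>This is \<open>powr_mean_le\<close> with exponent t / s, applied to |x|^s.\<close>

lemma lp_le_card_powr_lp:
  fixes x :: "'a \<Rightarrow> real"
  assumes "finite A" "0 < s" "s \<le> t"
  shows "(\<Sum>i\<in>A. \<bar>x i\<bar> powr s) powr (1 / s)
    \<le> real (card A) powr (1 / s - 1 / t) * (\<Sum>i\<in>A. \<bar>x i\<bar> powr t) powr (1 / t)"
proof -
  have "(\<Sum>i\<in>A. \<bar>x i\<bar> powr s) powr (t / s)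
      \<le> real (card A) powr (t / s - 1) * (\<Sum>i\<in>A. (\<bar>x i\<bar> powr s) powr (t / s))"
    using assms by (intro powr_mean_le) auto
  then have "((\<Sum>i\<in>A. \<bar>x i\<bar> powr s) powr (t / s)) powr (1 / t)
      \<le> (real (card A) powr (t / s - 1) * (\<Sum>i\<in>A. \<bar>x i\<bar> powr t)) powr (1 / t)"
    using assms by (intro powr_mono2) (auto simp: powr_powr)
  also have "\<dots> = real (card A) powr (1 / s - 1 / t) * (\<Sum>i\<in>A. \<bar>x i\<bar> powr t) powr (1 / t)"
    using assms by (simp add: powr_mult sum_nonneg powr_powr field_simps)
  finally show ?thesis
    using assms by (simp add: powr_powr)
qed

text \<open>Of the two passages to exponent 2 and back, one is free by
  \<open>lp_mono_exponent\<close> and the other costs a power of the cardinality. Which is which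
  depends on the side of 2 on which \<open>q\<close> lies, so the loss occurs only once.\<close>

lemma lp_le_of_l2_le:
  fixes x y :: "'a \<Rightarrow> real"
  assumes "finite A" "0 < q" "0 \<le> c"
    and l2: "(\<Sum>i\<in>A. \<bar>x i\<bar> powr 2) powr (1 / 2) \<le> c * (\<Sum>i\<in>A. \<bar>y i\<bar> powr 2) powr (1 / 2)"
  shows "(\<Sum>i\<in>A. \<bar>x i\<bar> powr q) powr (1 / q)
    \<le> c * real (card A) powr \<bar>1 / q - 1 / 2\<bar> * (\<Sum>i\<in>A. \<bar>y i\<bar> powr q) powr (1 / q)"
proof (cases "q \<le> 2")
  case True
  have "(\<Sum>i\<in>A. \<bar>x i\<bar> powr q) powr (1 / q)
      \<le> real (card A) powr (1 / q - 1 / 2) * (\<Sum>i\<in>A. \<bar>x i\<bar> powr 2) powr (1 / 2)"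
    using True assms by (intro lp_le_card_powr_lp)
  also have "\<dots> \<le> real (card A) powr (1 / q - 1 / 2) * (c * (\<Sum>i\<in>A. \<bar>y i\<bar> powr 2) powr (1 / 2))"
    using l2 by (intro mult_left_mono) auto
  also have "\<dots> \<le> real (card A) powr (1 / q - 1 / 2) * (c * (\<Sum>i\<in>A. \<bar>y i\<bar> powr q) powr (1 / q))"
    using True assms by (intro mult_left_mono lp_mono_exponent) auto
  also have "1 / q - 1 / 2 = \<bar>1 / q - 1 / 2\<bar>"
    using True assms by (simp add: field_simps)
  finally show ?thesis by (simp add: ac_simps)
next
  case False
  have "(\<Sum>i\<in>A. \<bar>x i\<bar> powr q) powr (1 / q) \<le> (\<Sum>i\<in>A. \<bar>x i\<bar> powr 2) powr (1 / 2)"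
    using False assms by (intro lp_mono_exponent) auto
  also note l2
  also have "c * (\<Sum>i\<in>A. \<bar>y i\<bar> powr 2) powr (1 / 2)
      \<le> c * (real (card A) powr (1 / 2 - 1 / q) * (\<Sum>i\<in>A. \<bar>y i\<bar> powr q) powr (1 / q))"
    using False assms by (intro mult_left_mono lp_le_card_powr_lp) auto
  also have "1 / 2 - 1 / q = \<bar>1 / q - 1 / 2\<bar>"
    using False assms by (simp add: field_simps)
  finally show ?thesis by (simp add: ac_simps)
qed

section \<open>The lower bound\<close>

definition ratio :: real where
  "ratio = 2 / cmod (1 + exp (pi * \<i> / 4))"

lemma ratio_gt_1: "1 < ratio"
proof -
  have "sqrt 2 < (2::real)"
    by (simp add: real_less_lsqrt)
  then have "(cmod (1 + exp (pi * \<i> / 4)))\<^sup>2 < 2\<^sup>2"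
    unfolding cmod_one_plus_exp by simp
  then have "cmod (1 + exp (pi * \<i> / 4)) < 2"
    by (rule power_less_imp_less_base) simp
  moreover have "0 < (cmod (1 + exp (pi * \<i> / 4)))\<^sup>2"
    unfolding cmod_one_plus_exp by (simp add: add_pos_pos)
  then have "0 < cmod (1 + exp (pi * \<i> / 4))"
    unfolding zero_less_power2 by (rule less_le[THEN iffD2, OF conjI[OF norm_ge_zero not_sym]])
  ultimately show ?thesis
    by (simp add: ratio_def)
qed

lemma ratio_squared: "ratio\<^sup>2 = 4 / (2 + sqrt 2)"
  by (simp add: ratio_def power_divide cmod_one_plus_exp)

abbreviation set_deriv :: "nat \<Rightarrow> int \<Rightarrow> real" where
  "set_deriv k \<equiv> discrete_deriv k (indicat_real per_set)"

abbreviation max_deriv :: "nat \<Rightarrow> int \<Rightarrow> real" where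
  "max_deriv k \<equiv> discrete_deriv k per_max"

lemma corr_0: "corr g 0 = (\<Sum>n\<in>{0..<8}. \<bar>g n\<bar> powr 2)"
  by (simp add: corr_def power2_eq_square)

text \<open>The square root of \<open>corr_ratio\<close>, with 144 = 12^2 and
  \<open>ratio_squared\<close>.\<close>

lemma l2_ratio:
  "corr (set_deriv k) 0 powr (1 / 2) \<le> 12 / ratio ^ k * corr (max_deriv k) 0 powr (1 / 2)"
proof -
  have b: "0 < (2 + sqrt 2) ^ k"
    by (simp add: add_pos_pos)
  have "(ratio ^ k)\<^sup>2 = (ratio\<^sup>2) ^ k"
    by (simp add: mult.commute flip: power_mult)
  then have "(ratio ^ k)\<^sup>2 = 4 ^ k / (2 + sqrt 2) ^ k"
    by (simp add: ratio_squared power_divide)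
  then have "(ratio ^ k)\<^sup>2 * corr (set_deriv k) 0 \<le> 12\<^sup>2 * corr (max_deriv k) 0"
    using corr_ratio[of k] b by (simp add: field_simps)
  then have "corr (set_deriv k) 0 \<le> 12\<^sup>2 * corr (max_deriv k) 0 / (ratio ^ k)\<^sup>2"
    using ratio_gt_1 by (subst pos_le_divide_eq) (simp_all add: mult.commute)
  then have "corr (set_deriv k) 0 \<le> (12 / ratio ^ k)\<^sup>2 * corr (max_deriv k) 0"
    by (simp only: power_divide times_divide_eq_left)
  then have "sqrt (corr (set_deriv k) 0) \<le> sqrt ((12 / ratio ^ k)\<^sup>2 * corr (max_deriv k) 0)"
    by (rule real_sqrt_le_mono)
  also have "\<dots> = 12 / ratio ^ k * sqrt (corr (max_deriv k) 0)"
    unfolding real_sqrt_mult real_sqrt_abs using ratio_gt_1 by simp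
  finally show ?thesis
    using corr_pos[of k] by (simp add: powr_half_sqrt)
qed

lemma lp_ratio:
  assumes "0 < q"
  shows "1 / (12 * 8 powr \<bar>1 / q - 1 / 2\<bar>) * ratio ^ k * (\<Sum>n\<in>{0..<8}. \<bar>set_deriv k n\<bar> powr q) powr (1 / q)
    \<le> (\<Sum>n\<in>{0..<8}. \<bar>max_deriv k n\<bar> powr q) powr (1 / q)"
proof -
  have "(\<Sum>n\<in>{0..<8}. \<bar>set_deriv k n\<bar> powr q) powr (1 / q) \<le>
    12 / ratio ^ k * real (card {0..<8::int}) powr \<bar>1 / q - 1 / 2\<bar> *
      (\<Sum>n\<in>{0..<8}. \<bar>max_deriv k n\<bar> powr q) powr (1 / q)"
    using assms l2_ratio ratio_gt_1 by (intro lp_le_of_l2_le) (auto simp: corr_0)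
  then show ?thesis
    using ratio_gt_1 by (simp add: field_simps)
qed

lemma sum_period_pos:
  assumes "0 < corr g 0"
  shows "0 < (\<Sum>n\<in>{0..<8}. \<bar>g n\<bar> powr q)"
proof -
  obtain n where "n \<in> {0..<8}" "g n \<noteq> 0"
  proof -
    have "corr g 0 \<noteq> 0"
      using assms by simp
    then show thesis
      unfolding corr_def using that by (elim sum.not_neutral_contains_not_neutral) simp
  qed
  then show ?thesis
    by (intro sum_pos2[of _ n]) auto
qed

section \<open>Summation over many periods with boundary errors\<close>

lemma periodic_shift:
  fixes h :: "int \<Rightarrow> 'a" and j :: int
  assumes "\<And>n. h (n + 8) = h n"
  shows "h (n + 8 * j) = h n"
proof (induction j rule: int_induct[where k = 0])
  case (step1 j)
  then show ?case
    using assms[of "n + 8 * j"] by (simp add: algebra_simps)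
next
  case (step2 j)
  then show ?case
    using assms[of "n + 8 * (j - 1)"] by (simp add: algebra_simps)
qed simp

lemma sum_periods:
  fixes h :: "int \<Rightarrow> real"
  assumes "\<And>n. h (n + 8) = h n"
  shows "(\<Sum>n\<in>{0..<8 * int j}. h n) = real j * (\<Sum>n\<in>{0..<8}. h n)"
proof (induction j)
  case (Suc j)
  have shift: "h (n + 8 * int j) = h n" for n
    by (rule periodic_shift) (rule assms)
  have "{0..<8 * int (Suc j)} = {0..<8 * int j} \<union> {8 * int j..<8 * int j + 8}"
    by auto
  then have "(\<Sum>n\<in>{0..<8 * int (Suc j)}. h n)
      = (\<Sum>n\<in>{0..<8 * int j}. h n) + (\<Sum>n\<in>{8 * int j..<8 * int j + 8}. h n)"
    by (simp only:) (rule sum.union_disjoint, auto)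
  also have "(\<Sum>n\<in>{8 * int j..<8 * int j + 8}. h n) = (\<Sum>n\<in>{0..<8}. h n)"
    using shift[of "n - 8 * int j" for n]
    by (intro sum.reindex_bij_witness[of _ "\<lambda>n. n + 8 * int j" "\<lambda>n. n - 8 * int j"]) simp_all
  finally show ?case
    using Suc.IH by (simp add: algebra_simps)
qed simp

text \<open>The boundary contributes at most 2 k terms of size at most 2^k, a quantity independent
  of \<open>m\<close>.\<close>

lemma lp_norm_B_seq_le:
  assumes "1 \<le> q"
  shows "lp_norm (ennreal q) (discrete_deriv k (indicat_real (B_seq m)))
    \<le> ennreal ((real m * (\<Sum>n\<in>{0..<8}. \<bar>set_deriv k n\<bar> powr q) + 2 * real k * (2 ^ k) powr q) powr (1 / q))"
proof -
  let ?g = "discrete_deriv k (indicat_real (B_seq m))"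
  \<comment> \<open>Stencils extend to the right, so those crossing 0 or 8 m start at the
    \<open>k\<close> points to the left of it.\<close>
  let ?A = "{0..<8 * int m}" and ?E = "{- int k..<0} \<union> {8 * int m - int k..<8 * int m}"
  have zero: "?g n = 0" if "n \<notin> ?A \<union> ?E" for n
  proof -
    have "?g n = discrete_deriv k (\<lambda>_. 0) n"
      by (rule discrete_deriv_cong) (use that in \<open>auto simp: B_seq_eq indicator_def\<close>)
    then show ?thesis by (simp add: discrete_deriv_zero)
  qed
  have bound: "\<bar>?g n\<bar> \<le> 2 ^ k" for n
    using discrete_deriv_bounded[of "indicat_real (B_seq m)" 1 k n] by (simp add: indicator_def)
  have inner: "?g n = set_deriv k n" if "n \<in> ?A" "n \<notin> ?E" for n
    by (rule discrete_deriv_cong) (use that in \<open>auto simp: B_seq_eq indicator_def\<close>)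
  have fin: "(\<Sum>\<^sub>\<infinity>n. \<bar>?g n\<bar> powr q) = (\<Sum>n\<in>?A \<union> ?E. \<bar>?g n\<bar> powr q)"
  proof -
    have "(\<Sum>\<^sub>\<infinity>n. \<bar>?g n\<bar> powr q) = (\<Sum>\<^sub>\<infinity>n\<in>?A \<union> ?E. \<bar>?g n\<bar> powr q)"
      by (rule infsum_cong_neutral) (use zero in auto)
    then show ?thesis by simp
  qed
  have summable: "(\<lambda>n. \<bar>?g n\<bar> powr q) summable_on UNIV"
    using zero summable_on_finite[of "?A \<union> ?E" "\<lambda>n. \<bar>?g n\<bar> powr q"]
    by (subst summable_on_cong_neutral[where T = "?A \<union> ?E" and g = "\<lambda>n. \<bar>?g n\<bar> powr q"]) auto
  have "(\<Sum>n\<in>?A \<union> ?E. \<bar>?g n\<bar> powr q) = (\<Sum>n\<in>(?A - ?E) \<union> ?E. \<bar>?g n\<bar> powr q)"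
    by (rule sum.cong) auto
  also have "\<dots> = (\<Sum>n\<in>?A - ?E. \<bar>?g n\<bar> powr q) + (\<Sum>n\<in>?E. \<bar>?g n\<bar> powr q)"
    by (rule sum.union_disjoint) auto
  also have "(\<Sum>n\<in>?A - ?E. \<bar>?g n\<bar> powr q) = (\<Sum>n\<in>?A - ?E. \<bar>set_deriv k n\<bar> powr q)"
    using inner by (intro sum.cong) auto
  also have "\<dots> \<le> (\<Sum>n\<in>?A. \<bar>set_deriv k n\<bar> powr q)"
    by (intro sum_mono2) auto
  also have "\<dots> = real m * (\<Sum>n\<in>{0..<8}. \<bar>set_deriv k n\<bar> powr q)"
    by (rule sum_periods) (simp add: discrete_deriv_shift_invariant per_set_shift)
  also have "(\<Sum>n\<in>?E. \<bar>?g n\<bar> powr q) \<le> real (card ?E) * (2 ^ k) powr q"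
    using bound assms by (intro sum_bounded_above powr_mono2) auto
  also have "\<dots> \<le> 2 * real k * (2 ^ k) powr q"
    using card_Un_le[of "{- int k..<0}" "{8 * int m - int k..<8 * int m}"]
    by (intro mult_right_mono) auto
  finally have "(\<Sum>n\<in>?A \<union> ?E. \<bar>?g n\<bar> powr q) \<le> real m * (\<Sum>n\<in>{0..<8}. \<bar>set_deriv k n\<bar> powr q) + 2 * real k * (2 ^ k) powr q"
    by simp
  then show ?thesis
    using summable assms unfolding lp_norm_def
    by (auto simp: fin intro!: ennreal_leI powr_mono2 sum_nonneg)
qed

text \<open>Only whole periods inside the set are kept. The tail of the maximal function decays
  slowly, so the norm can be infinite (as for k = 0, q = 1), in which case the bound is
  trivial.\<close>

lemma lp_norm_max_B_seq_ge:
  assumes "1 \<le> q" "k + 1 \<le> m"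
  shows "ennreal (((real m - 1 - real k) * (\<Sum>n\<in>{0..<8}. \<bar>max_deriv k n\<bar> powr q)) powr (1 / q))
    \<le> lp_norm (ennreal q) (discrete_deriv k (maximal_fun (indicat_real (B_seq m))))"
proof -
  let ?g = "discrete_deriv k (maximal_fun (indicat_real (B_seq m)))"
  \<comment> \<open>Dropping \<open>k\<close> more periods generously keeps every stencil below 8 (m
    - 1), where \<open>maximal_fun_B_seq\<close> applies.\<close>
  let ?A = "{0..<8 * int (m - 1 - k)}"
  have inner: "?g n = max_deriv k n" if "n \<in> ?A" for n
    by (rule discrete_deriv_cong) (use that assms in \<open>auto intro!: maximal_fun_B_seq\<close>)
  have "(real m - 1 - real k) * (\<Sum>n\<in>{0..<8}. \<bar>max_deriv k n\<bar> powr q) =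
     real (m - 1 - k) * (\<Sum>n\<in>{0..<8}. \<bar>max_deriv k n\<bar> powr q)"
    using assms by (simp add: of_nat_diff)
  also have "\<dots> = (\<Sum>n\<in>?A. \<bar>max_deriv k n\<bar> powr q)"
    by (rule sum_periods[symmetric]) (simp add: discrete_deriv_shift_invariant per_max_shift)
  also have "\<dots> = (\<Sum>n\<in>?A. \<bar>?g n\<bar> powr q)"
    using inner by (intro sum.cong) auto
  finally have eq: "(real m - 1 - real k) * (\<Sum>n\<in>{0..<8}. \<bar>max_deriv k n\<bar> powr q) = (\<Sum>n\<in>?A. \<bar>?g n\<bar> powr q)" .
  show ?thesis
    using assms unfolding lp_norm_def eq
    by (auto intro!: ennreal_leI powr_mono2 sum_nonneg finite_sum_le_infsum)
qed

text \<open>The division \<open>1 / p\<close> takes place in \<open>ennreal\<close>, where it gives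
  0 for infinite \<open>p\<close>.\<close>

definition lower_bound :: "nat \<Rightarrow> ennreal \<Rightarrow> real" where
  "lower_bound k p = 1 / (12 * 8 powr \<bar>enn2real (1 / p) - 1 / 2\<bar>) * ratio ^ k"

text \<open>The boundary terms are fixed while the main terms are linear in \<open>m\<close>, so the
  quotient of the bounds tends to the quotient for a single period, where \<open>lp_ratio\<close>
  applies.\<close>

lemma liminf_ratio:
  assumes "1 \<le> p" "p < \<infinity>"
  shows "ennreal (lower_bound k p) \<le>
    liminf (\<lambda>m. lp_norm p (discrete_deriv k (maximal_fun (indicat_real (B_seq m))))
                  / lp_norm p (discrete_deriv k (indicat_real (B_seq m))))"
proof -
  obtain q where p: "p = ennreal q" and "0 \<le> q"
    using assms by (cases p) auto
  then have q: "1 \<le> q"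
    using assms by simp
  define PF where "PF = (\<Sum>n\<in>{0..<8}. \<bar>set_deriv k n\<bar> powr q)"
  define PM where "PM = (\<Sum>n\<in>{0..<8}. \<bar>max_deriv k n\<bar> powr q)"
  define K where "K = 2 * real k * (2 ^ k) powr q"
  have pos: "0 < PF" "0 < PM" "0 \<le> K"
    using sum_period_pos corr_pos by (auto simp: PF_def PM_def K_def)
  let ?X = "\<lambda>m. lp_norm p (discrete_deriv k (maximal_fun (indicat_real (B_seq m))))
                  / lp_norm p (discrete_deriv k (indicat_real (B_seq m)))"
  let ?Y = "\<lambda>m. (((real m - 1 - real k) * PM) / (real m * PF + K)) powr (1 / q)"
  \<comment> \<open>From k + 1 on the numerator is nonnegative, as splitting the quotient and its
    power requires.\<close>
  have le: "ennreal (?Y m) \<le> ?X m" if m: "k + 1 \<le> m" for m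
  proof -
    have D: "0 < real m * PF + K"
      using pos m by (intro add_pos_nonneg) auto
    have "ennreal (?Y m) = ennreal (((real m - 1 - real k) * PM) powr (1 / q)) / ennreal ((real m * PF + K) powr (1 / q))"
      using D pos m by (subst divide_ennreal) (auto simp: powr_divide)
    also have "\<dots> \<le> lp_norm p (discrete_deriv k (maximal_fun (indicat_real (B_seq m)))) / ennreal ((real m * PF + K) powr (1 / q))"
      using lp_norm_max_B_seq_ge[OF q m] by (intro divide_right_mono_ennreal) (simp add: p PM_def)
    also have "\<dots> \<le> ?X m"
      using lp_norm_B_seq_le[OF q, of k m] unfolding p PF_def K_def
      by (rule divide_left_mono_ennreal)
    finally show ?thesis .
  qed
  \<comment> \<open>Numerator and denominator are divided by \<open>m\<close>, so this agrees with
    the quotient only for m > 0.\<close>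
  have "(\<lambda>m. ((1 - (1 + real k) * (1 / real m)) * PM) / (PF + K * (1 / real m)))
      \<longlonglongrightarrow> ((1 - (1 + real k) * 0) * PM) / (PF + K * 0)"
    using pos by (intro tendsto_intros lim_1_over_n) auto
  moreover have "eventually (\<lambda>m. ((1 - (1 + real k) * (1 / real m)) * PM) / (PF + K * (1 / real m))
     = ((real m - 1 - real k) * PM) / (real m * PF + K)) sequentially"
    using eventually_gt_at_top[of 0]
  proof eventually_elim
    case (elim m)
    then have "(1 - (1 + real k) * (1 / real m)) * PM = ((real m - 1 - real k) * PM) / real m"
      "PF + K * (1 / real m) = (real m * PF + K) / real m"
      by (simp_all add: field_simps)
    then show ?case using elim by simp
  qed
  ultimately have "(\<lambda>m. ((real m - 1 - real k) * PM) / (real m * PF + K)) \<longlonglongrightarrow> PM / PF"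
    by (auto elim: Lim_transform_eventually)
  then have "?Y \<longlonglongrightarrow> (PM / PF) powr (1 / q)"
    using pos by (intro tendsto_powr tendsto_const) auto
  then have lim: "(\<lambda>m. ennreal (?Y m)) \<longlonglongrightarrow> ennreal ((PM / PF) powr (1 / q))"
    by (rule tendsto_ennrealI)
  have "enn2real (1 / p) = 1 / q"
    using q by (simp add: p divide_ennreal flip: ennreal_1)
  then have "lower_bound k p * PF powr (1 / q) \<le> PM powr (1 / q)"
    using lp_ratio[of q k] q by (simp add: lower_bound_def PF_def PM_def)
  then have "lower_bound k p \<le> (PM / PF) powr (1 / q)"
    using pos by (simp add: powr_divide field_simps)
  then have "ennreal (lower_bound k p) \<le> liminf (\<lambda>m. ennreal (?Y m))"
    using lim_imp_Liminf[OF _ lim] by (simp add: ennreal_leI)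
  also have "\<dots> \<le> liminf ?X"
    using le by (intro Liminf_mono eventually_sequentiallyI[of "k + 1"])
  finally show ?thesis .
qed

section \<open>Passage to the best constant\<close>

lemma divide_le_best_const:
  assumes "lp_norm p (discrete_deriv k (indicat_real S)) < \<infinity>"
  shows "lp_norm p (discrete_deriv k (maximal_fun (indicat_real S)))
    / lp_norm p (discrete_deriv k (indicat_real S)) \<le> best_const k p"
proof -
  let ?a = "lp_norm p (discrete_deriv k (maximal_fun (indicat_real S)))"
    and ?b = "lp_norm p (discrete_deriv k (indicat_real S))"
  have "?a / ?b \<le> best_const k p * ?b / ?b"
    using best_const_least(1)[of k p] assms
    by (intro divide_right_mono_ennreal) (simp add: admissible_const_def)
  \<comment> \<open>For \<open>?b = 0\<close> the left side is 0 / 0 = 0 in \<open>ennreal\<close>;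
    otherwise the finite factor cancels.\<close>
  also have "\<dots> \<le> best_const k p"
    using assms by (cases "?b = 0") (auto simp: ennreal_mult_divide_eq)
  finally show ?thesis .
qed

lemma best_const_ge_finite:
  assumes "1 \<le> p" "p < \<infinity>"
  shows "ennreal (lower_bound k p) \<le> best_const k p"
proof -
  obtain q where p: "p = ennreal q" and "0 \<le> q"
    using assms by (cases p) auto
  then have q: "1 \<le> q"
    using assms by simp
  have "lp_norm p (discrete_deriv k (indicat_real (B_seq m))) < \<infinity>" for m
    using lp_norm_B_seq_le[OF q, of k m] unfolding p by (rule order.strict_trans1) simp
  then have "liminf (\<lambda>m. lp_norm p (discrete_deriv k (maximal_fun (indicat_real (B_seq m))))
                  / lp_norm p (discrete_deriv k (indicat_real (B_seq m)))) \<le> liminf (\<lambda>m::nat. best_const k p)"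
    by (intro Liminf_mono always_eventually allI divide_le_best_const)
  then show ?thesis
    using liminf_ratio[OF assms, of k] by (simp add: Liminf_const)
qed

text \<open>The sup norm is at most the l^2 norm over a period (used for \<open>per_set\<close>) and
  at least that norm divided by sqrt 8 (used for \<open>per_max\<close>); this is the loss 8^|0 -
  1/2|.\<close>

lemma best_const_ge_infinity: "ennreal (lower_bound k \<infinity>) \<le> best_const k \<infinity>"
proof -
  let ?F = "corr (set_deriv k) 0 powr (1 / 2)" and ?M = "corr (max_deriv k) 0 powr (1 / 2)"
  have sup: "lp_norm \<infinity> g = (SUP n. ennreal \<bar>g n\<bar>)" for g
    by (simp add: lp_norm_def)
  have "\<bar>set_deriv k n\<bar> \<le> ?F" for n
  proof -
    have "set_deriv k (n mod 8 + 8 * (n div 8)) = set_deriv k (n mod 8)"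
      by (intro periodic_shift discrete_deriv_shift_invariant per_set_shift)
    then have "set_deriv k n = set_deriv k (n mod 8)"
      by simp
    moreover have "\<bar>set_deriv k (n mod 8)\<bar> powr 2 \<le> corr (set_deriv k) 0"
      unfolding corr_0 by (rule member_le_sum) auto
    ultimately have "(\<bar>set_deriv k n\<bar> powr 2) powr (1 / 2) \<le> ?F"
      by (intro powr_mono2) auto
    then show ?thesis by (simp add: powr_powr)
  qed
  then have F: "lp_norm \<infinity> (set_deriv k) \<le> ennreal ?F"
    unfolding sup by (intro SUP_least ennreal_leI)
  define b where "b = Max ((\<lambda>n. \<bar>max_deriv k n\<bar>) ` {0..<8})"
  have "?M \<le> (\<Sum>n\<in>{0..<8::int}. b powr 2) powr (1 / 2)"
    unfolding corr_0 by (intro powr_mono2 sum_mono sum_nonneg) (auto simp: b_def)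
  also have "\<dots> = 8 powr (1 / 2) * b"
  proof -
    have "0 \<le> b"
      unfolding b_def by (rule order_trans[OF abs_ge_zero Max_ge[of _ "\<bar>max_deriv k 0\<bar>"]]) auto
    then show ?thesis by (simp add: powr_mult powr_powr powr_half_sqrt real_sqrt_mult)
  qed
  finally have M: "?M / 8 powr (1 / 2) \<le> b"
    by (simp add: field_simps)
  have "b \<in> (\<lambda>n. \<bar>max_deriv k n\<bar>) ` {0..<8}"
    unfolding b_def by (intro Max_in) auto
  then have "ennreal b \<le> lp_norm \<infinity> (max_deriv k)"
    unfolding sup by (auto intro: SUP_upper)
  then have M: "ennreal (?M / 8 powr (1 / 2)) \<le> lp_norm \<infinity> (max_deriv k)"
    using M ennreal_leI order_trans by blast
  have "lower_bound k \<infinity> \<le> (?M / 8 powr (1 / 2)) / ?F"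
    using l2_ratio[of k] corr_pos[of k] ratio_gt_1 by (simp add: lower_bound_def field_simps)
  then have "ennreal (lower_bound k \<infinity>) \<le> ennreal ((?M / 8 powr (1 / 2)) / ?F)"
    by (rule ennreal_leI)
  also have "\<dots> = ennreal (?M / 8 powr (1 / 2)) / ennreal ?F"
    using corr_pos[of k] by (subst divide_ennreal) auto
  also have "\<dots> \<le> lp_norm \<infinity> (max_deriv k) / ennreal ?F"
    by (intro divide_right_mono_ennreal M)
  also have "\<dots> \<le> lp_norm \<infinity> (max_deriv k) / lp_norm \<infinity> (set_deriv k)"
    by (rule divide_left_mono_ennreal[OF F])
  also have "\<dots> \<le> best_const k \<infinity>"
    using divide_le_best_const[of \<infinity> k per_set] F order.strict_trans1[OF F]
    by (simp add: maximal_fun_per_set)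
  finally show ?thesis .
qed

lemma best_const_ge:
  assumes "1 \<le> p"
  shows "ennreal (lower_bound k p) \<le> best_const k p"
  using best_const_ge_finite[OF assms] best_const_ge_infinity[of k] by (cases "p = \<infinity>") (auto simp: less_top)

text \<open>As 1/p lies in [0, 1], the exponent |1/p - 1/2| is at most 1/2. This gives exponential
  growth at the rate \<open>ratio\<close> with a constant independent of \<open>p\<close>.\<close>

lemma lower_bound_ge:
  assumes "1 \<le> p"
  shows "1 / (12 * 8 powr (1 / 2)) * ratio ^ k \<le> lower_bound k p"
proof -
  have "1 / p \<le> 1"
    using assms by (intro divide_le_posI_ennreal less_le_trans[OF zero_less_one]) auto
  then have "enn2real (1 / p) \<le> 1"
    by (simp add: enn2real_leI)
  then have "\<bar>enn2real (1 / p) - 1 / 2\<bar> \<le> 1 / 2"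
    using enn2real_nonneg[of "1 / p"] by linarith
  then have "8 powr \<bar>enn2real (1 / p) - 1 / 2\<bar> \<le> (8::real) powr (1 / 2)"
    by (intro powr_mono) auto
  then show ?thesis
    unfolding lower_bound_def using ratio_gt_1
    by (intro mult_right_mono divide_left_mono) auto
qed

theorem theorem2p8:
  shows "(\<forall>(k::nat) (p::ennreal). 1 \<le> p \<longrightarrow>
            best_const k p
              \<ge> ennreal (1 / (12 * 8 powr \<bar>enn2real (1 / p) - 1 / 2\<bar>)
                          * (2 / cmod (1 + exp (pi * \<i> / 4))) ^ k))
       \<and> (\<exists>c q :: real. 0 < c \<and> 1 < q \<and>
            (\<forall>(k::nat) (p::ennreal). 1 \<le> p \<longrightarrow> best_const k p \<ge> ennreal (c * q ^ k)))
       \<and> (\<forall>(k::nat) (p::ennreal). 1 \<le> p \<longrightarrow> p < \<infinity> \<longrightarrow>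
            liminf (\<lambda>m. lp_norm p (discrete_deriv k (maximal_fun (indicat_real (B_seq m))))
                         / lp_norm p (discrete_deriv k (indicat_real (B_seq m))))
              \<ge> ennreal (1 / (12 * 8 powr \<bar>enn2real (1 / p) - 1 / 2\<bar>)
                          * (2 / cmod (1 + exp (pi * \<i> / 4))) ^ k))"
proof (intro conjI allI impI)
  fix k :: nat and p :: ennreal
  assume p: "1 \<le> p"
  show "ennreal (1 / (12 * 8 powr \<bar>enn2real (1 / p) - 1 / 2\<bar>)
      * (2 / cmod (1 + exp (pi * \<i> / 4))) ^ k) \<le> best_const k p"
    using best_const_ge[OF p] unfolding lower_bound_def ratio_def .
  assume fin: "p < \<infinity>"
  show "ennreal (1 / (12 * 8 powr \<bar>enn2real (1 / p) - 1 / 2\<bar>)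
      * (2 / cmod (1 + exp (pi * \<i> / 4))) ^ k) \<le>
    liminf (\<lambda>m. lp_norm p (discrete_deriv k (maximal_fun (indicat_real (B_seq m))))
                         / lp_norm p (discrete_deriv k (indicat_real (B_seq m))))"
    using liminf_ratio[OF p fin] unfolding lower_bound_def ratio_def .
next
  show "\<exists>c q :: real. 0 < c \<and> 1 < q \<and>
     (\<forall>(k::nat) (p::ennreal). 1 \<le> p \<longrightarrow> best_const k p \<ge> ennreal (c * q ^ k))"
  proof (rule exI[of _ "1 / (12 * 8 powr (1 / 2))"], rule exI[of _ ratio], intro conjI allI impI)
    fix k :: nat and p :: ennreal
    assume p: "1 \<le> p"
    show "ennreal (1 / (12 * 8 powr (1 / 2)) * ratio ^ k) \<le> best_const k p"
      using ennreal_leI[OF lower_bound_ge[OF p]] best_const_ge[OF p] by (rule order_trans)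
  qed (use ratio_gt_1 in simp_all)
qed

end
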